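(* Let $\mathcal{S}\subset\mathbb{R}^d$ be a dataset of $n$ vectors, let $0<c<1$ and $S_0>0$ be the parameters of $c$-approximate maximum inner product search (MIPS), and let $U=\max_{x\in\mathcal{S}}\|x\|$. Let $$G(c,s)=\frac{\log\left(1-\frac{\cos^{-1}(s)}{\pi}\right)}{\log\left(1-\frac{\cos^{-1}(cs)}{\pi}\right)}.$$ RANGE-LSH (defined in the context) attains a lower query time complexity upper bound than that of SIMPLE-LSH for $c$-approximate MIPS with sufficiently large $n$, if the dataset is partitioned into $m=n^{\alpha}$ sub-datasets $\mathcal{S}_1,\dots,\mathcal{S}_m$ and there are at most $n^{\beta}$ sub-datasets with $U_j=U$, where $U_j=\max_{x\in\mathcal{S}_j}\|x\|$ and $$0<\alpha<\min\left\{\rho,\ \frac{\rho-\rho^{\star}}{1-\rho^{\star}}\right\},\qquad 0<\beta<\alpha\rho,$$ $$\rho^{\star}=\max_{\rho_j<\rho}\rho_j,\qquad \rho_j=G(c,S_0/U_j),\qquad \rho=G(c,S_0/U).$$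
   Context: Norms are Euclidean (2-norms), and queries $q\in\mathbb{R}^d$ are normalized to $\|q\|=1$. **$c$-approximate MIPS.** Given parameters $S_0>0$ and $\delta>0$: if some $x\in\mathcal{S}$ has inner product at least $S_0$ with the query $q$, return, with probability at least $1-\delta$, some item of $\mathcal{S}$ whose inner product with $q$ is at least $cS_0$. **SIMPLE-LSH.** Given a dataset of $N$ vectors with maximum norm $V$, it divides all vectors by $V$, maps each resulting $x$ to $P(x)=[x;\sqrt{1-\|x\|^2}]$ and each query $q$ to $[q;0]$, and applies locality sensitive hashing with sign random projections $h_a(x)=\mathrm{sign}(a^\top x)$, where the entries of $a$ are i.i.d. standard normal. Its query time complexity upper bound for $c$-approximate MIPS is $\mathcal{O}(N^{G(c,S_0/V)}\log N)$, with $G$ as in the claim. On the whole dataset $\mathcal{S}$ this bound is $\mathcal{O}(n^{\rho}\log n)$. **RANGE-LSH (norm-ranging LSH).** Index building: rank the items of $\mathcal{S}$ by their norms (ties broken arbitrarily). Partition $\mathcal{S}$ into $m$ sub-datasets $\mathcal{S}_1,\dots,\mathcal{S}_m$, where $\mathcal{S}_j$ holds the items whose norms are ranked in the range $[\frac{(j-1)n}{m},\frac{jn}{m}]$. For each $j$, normalize $\mathcal{S}_j$ by $U_j=\max_{x\in\mathcal{S}_j}\|x\|$ and apply SIMPLE-LSH to build an index for $\mathcal{S}_j$. Query processing: for each $j$, conduct MIPS with $q$ on the index of $\mathcal{S}_j$ (with the same $c,S_0,\delta$ for all sub-datasets) to get $x_j^\star$, then return the item among $x_1^\star,\dots,x_m^\star$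 that has the maximum inner product with $q$. Its query time complexity upper bound is obtained by adding the SIMPLE-LSH bounds over the $m$ sub-datasets, each of $n^{1-\alpha}$ items, and the $\mathcal{O}(m)$ cost of the final selection. Upper bounds are compared as orders in $n$, ignoring constants and non-dominant terms. *)

theory Defs
  imports "HOL-Probability.Probability"
begin

section \<open>Datasets and approximate MIPS\<close>

text \<open>A dataset is a list, so that repeated vectors are allowed and \<^term>\<open>length\<close> is the number
  of items.\<close>

definition max_norm :: "'a::real_normed_vector list \<Rightarrow> real" where
  "max_norm D = Max (norm ` set D)"

text \<open>\<open>M\<close> carries the random choices made when the index is built, and \<open>ans \<omega> q\<close> is the answer to
  the query \<open>q\<close> on the index built from \<open>\<omega>\<close> (\<open>None\<close> if nothing is returned). The success
  probability is required for each fixed query.\<close>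

definition solves_c_mips ::
  "'w measure \<Rightarrow> ('w \<Rightarrow> 'a::real_inner \<Rightarrow> 'a option) \<Rightarrow> real \<Rightarrow> real \<Rightarrow> real \<Rightarrow> 'a list \<Rightarrow> bool" where
  "solves_c_mips M ans c S0 \<delta> D \<longleftrightarrow>
     (\<forall>q. norm q = 1 \<and> (\<exists>x\<in>set D. x \<bullet> q \<ge> S0) \<longrightarrow>
        measure M {\<omega> \<in> space M. \<exists>y\<in>set D. ans \<omega> q = Some y \<and> y \<bullet> q \<ge> c * S0} \<ge> 1 - \<delta>)"

text \<open>Ties are resolved by the choice operator.\<close>

definition best_item :: "'a::real_inner \<Rightarrow> 'a set \<Rightarrow> 'a option" where
  "best_item q X = (if X = {} then None else Some (arg_max_on (\<lambda>x. x \<bullet> q) X))"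


section \<open>SIMPLE-LSH\<close>

text \<open>The product type \<open>'a \<times> real\<close>, with its Euclidean inner product, plays the role of
  \<open>d+1\<close>-dimensional space.\<close>

definition simple_transform :: "'a::real_normed_vector \<Rightarrow> 'a \<times> real" where
  "simple_transform x = (x, sqrt (1 - (norm x)\<^sup>2))"

definition query_transform :: "'a::real_normed_vector \<Rightarrow> 'a \<times> real" where
  "query_transform q = (q, 0)"

definition std_normal_vector :: "'b::euclidean_space measure" where
  "std_normal_vector =
     distr (Pi\<^sub>M Basis (\<lambda>_. density lborel std_normal_density)) borel (\<lambda>f. \<Sum>b\<in>Basis. f b *\<^sub>R b)"

definition sign_projection :: "'b::real_inner \<Rightarrow> 'b \<Rightarrow> real" where
  "sign_projection a x = sgn (a \<bullet> x)"

text \<open>The usual bucketing scheme: \<open>tables\<close> hash tables, each keyed by the concatenation of \<open>bits\<close>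
  hash values; a query inspects the items sharing a bucket with it, table by table, and stops
  after \<open>budget\<close> items.\<close>

record lsh_params =
  bits :: nat
  tables :: nat
  budget :: nat

definition simple_lsh_space ::
  "lsh_params \<Rightarrow> (nat \<times> nat \<Rightarrow> 'a::euclidean_space \<times> real) measure" where
  "simple_lsh_space p = Pi\<^sub>M ({..<tables p} \<times> {..<bits p}) (\<lambda>_. std_normal_vector)"

definition same_bucket ::
  "lsh_params \<Rightarrow> (nat \<times> nat \<Rightarrow> 'a::euclidean_space \<times> real) \<Rightarrow> real \<Rightarrow> 'a \<Rightarrow> nat \<Rightarrow> 'a \<Rightarrow> bool" where
  "same_bucket p \<omega> V q l x \<longleftrightarrow>
     (\<forall>k<bits p. sign_projection (\<omega> (l, k)) (simple_transform (x /\<^sub>R V))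
               = sign_projection (\<omega> (l, k)) (query_transform q))"

definition simple_lsh_inspected ::
  "lsh_params \<Rightarrow> 'a::euclidean_space list \<Rightarrow> (nat \<times> nat \<Rightarrow> 'a \<times> real) \<Rightarrow> 'a \<Rightarrow> 'a list" where
  "simple_lsh_inspected p D \<omega> q =
     take (budget p) (concat (map (\<lambda>l. filter (same_bucket p \<omega> (max_norm D) q l) D) [0..<tables p]))"

definition simple_lsh_answer ::
  "lsh_params \<Rightarrow> 'a::euclidean_space list \<Rightarrow> (nat \<times> nat \<Rightarrow> 'a \<times> real) \<Rightarrow> 'a \<Rightarrow> 'a option" where
  "simple_lsh_answer p D \<omega> q = best_item q (set (simple_lsh_inspected p D \<omega> q))"

text \<open>Evaluating one hash function or one inner product counts as one step.\<close>

definition simple_lsh_time ::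
  "lsh_params \<Rightarrow> 'a::euclidean_space list \<Rightarrow> (nat \<times> nat \<Rightarrow> 'a \<times> real) \<Rightarrow> 'a \<Rightarrow> nat" where
  "simple_lsh_time p D \<omega> q = tables p * bits p + length (simple_lsh_inspected p D \<omega> q)"

definition G :: "real \<Rightarrow> real \<Rightarrow> real" where
  "G c s = ln (1 - arccos s / pi) / ln (1 - arccos (c * s) / pi)"

text \<open>\<open>G c (S0 / V)\<close> is meaningful only for \<open>S0 \<le> V\<close>, since otherwise \<open>arccos\<close> is applied outside
  \<open>[-1, 1]\<close> (or \<open>V = 0\<close>). If \<open>V < S0\<close>, no item of a dataset with maximum norm \<open>V\<close> has inner product
  at least \<open>S0\<close> with a unit query, so MIPS on it is trivial; the exponent is then taken to be \<open>0\<close>,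
  which is also \<open>G c 1\<close>.\<close>

definition lsh_exponent :: "real \<Rightarrow> real \<Rightarrow> real \<Rightarrow> real" where
  "lsh_exponent c S0 V = (if S0 \<le> V then G c (S0 / V) else 0)"

text \<open>The query time bound of SIMPLE-LSH, up to a constant factor, for \<open>N\<close> items of maximum norm \<open>V\<close>.\<close>

definition simple_lsh_bound :: "real \<Rightarrow> real \<Rightarrow> nat \<Rightarrow> real \<Rightarrow> real" where
  "simple_lsh_bound c S0 N V = real N powr lsh_exponent c S0 V * ln (real N)"

text \<open>The known performance guarantee of SIMPLE-LSH, for a choice \<open>par\<close> of hashing parameters for
  every dataset. The time bound is an asymptotic one and has the value \<open>0\<close> at \<open>N = 1\<close>, hence the
  restriction to at least two items.\<close>

definition simple_lsh_guarantee ::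
  "real \<Rightarrow> real \<Rightarrow> real \<Rightarrow> real \<Rightarrow> ('a::euclidean_space list \<Rightarrow> lsh_params) \<Rightarrow> bool" where
  "simple_lsh_guarantee c S0 \<delta> A par \<longleftrightarrow>
     (\<forall>D. D \<noteq> [] \<longrightarrow>
        solves_c_mips (simple_lsh_space (par D)) (simple_lsh_answer (par D) D) c S0 \<delta> D) \<and>
     (\<forall>D q. \<forall>\<omega>\<in>space (simple_lsh_space (par D)). length D \<ge> 2 \<and> norm q = 1 \<longrightarrow>
        real (simple_lsh_time (par D) D \<omega> q) \<le> A * simple_lsh_bound c S0 (length D) (max_norm D))"


section \<open>RANGE-LSH\<close>

definition norm_ranking :: "'a::real_normed_vector list \<Rightarrow> 'a list \<Rightarrow> bool" where
  "norm_ranking D R \<longleftrightarrow> mset R = mset D \<and> sorted (map norm R)"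

text \<open>For \<open>1 \<le> j \<le> m\<close> and \<open>n = length R\<close>, the items of (1-based) rank \<open>i\<close> with
  \<open>(j-1)n/m < i \<le> jn/m\<close>; the range is half-open, so that the sub-datasets form a partition.\<close>

definition sub_dataset :: "nat \<Rightarrow> 'a list \<Rightarrow> nat \<Rightarrow> 'a list" where
  "sub_dataset m R j = drop ((j - 1) * length R div m) (take (j * length R div m) R)"

definition range_lsh_space ::
  "('a::euclidean_space list \<Rightarrow> lsh_params) \<Rightarrow> nat \<Rightarrow> 'a list \<Rightarrow> (nat \<Rightarrow> nat \<times> nat \<Rightarrow> 'a \<times> real) measure" where
  "range_lsh_space par m R = Pi\<^sub>M {1..m} (\<lambda>j. simple_lsh_space (par (sub_dataset m R j)))"

definition range_lsh_answer ::
  "('a::euclidean_space list \<Rightarrow> lsh_params) \<Rightarrow> nat \<Rightarrow> 'a list \<Rightarrow>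
     (nat \<Rightarrow> nat \<times> nat \<Rightarrow> 'a \<times> real) \<Rightarrow> 'a \<Rightarrow> 'a option" where
  "range_lsh_answer par m R \<omega> q =
     best_item q {x. \<exists>j\<in>{1..m}.
       simple_lsh_answer (par (sub_dataset m R j)) (sub_dataset m R j) (\<omega> j) q = Some x}"

definition range_lsh_time ::
  "('a::euclidean_space list \<Rightarrow> lsh_params) \<Rightarrow> nat \<Rightarrow> 'a list \<Rightarrow>
     (nat \<Rightarrow> nat \<times> nat \<Rightarrow> 'a \<times> real) \<Rightarrow> 'a \<Rightarrow> nat" where
  "range_lsh_time par m R \<omega> q =
     (\<Sum>j=1..m. simple_lsh_time (par (sub_dataset m R j)) (sub_dataset m R j) (\<omega> j) q) + m"

text \<open>\<open>A\<close> and \<open>C\<close> are the constants hidden in the SIMPLE-LSH bounds and in the cost of the final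
  selection.\<close>

definition range_lsh_bound ::
  "real \<Rightarrow> real \<Rightarrow> real \<Rightarrow> real \<Rightarrow> nat \<Rightarrow> 'a::real_normed_vector list \<Rightarrow> real" where
  "range_lsh_bound A C c S0 m R =
     (\<Sum>j=1..m. A * simple_lsh_bound c S0 (length (sub_dataset m R j)) (max_norm (sub_dataset m R j)))
     + C * real m"

text \<open>The hypotheses on a dataset \<open>D\<close> ranked as \<open>R\<close> and cut into \<open>m\<close> sub-datasets. Here \<open>m\<close> is
  \<open>n powr \<alpha>\<close>, exactly if that number is an integer and rounded up or down otherwise.\<close>

definition range_lsh_setting ::
  "real \<Rightarrow> real \<Rightarrow> real \<Rightarrow> real \<Rightarrow> real \<Rightarrow> real \<Rightarrow> 'a::real_normed_vector list \<Rightarrow> 'a list \<Rightarrow> nat \<Rightarrow> bool" where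
  "range_lsh_setting c S0 \<alpha> \<beta> \<rho> \<rho>star D R m \<longleftrightarrow>
     (let n = length D; U = max_norm D;
          Uj = (\<lambda>j. max_norm (sub_dataset m R j)); \<rho>j = (\<lambda>j. lsh_exponent c S0 (Uj j))
      in norm_ranking D R
       \<and> \<bar>real m - real n powr \<alpha>\<bar> < 1
       \<and> real (card {j \<in> {1..m}. Uj j = U}) \<le> real n powr \<beta>
       \<and> \<rho> = lsh_exponent c S0 U
       \<and> \<rho>star = Max {\<rho>j j | j. j \<in> {1..m} \<and> \<rho>j j < \<rho>})"

end

theory Submission
  imports Defs "HOL-Real_Asymp.Real_Asymp"
begin

text \<open>The exponent \<open>G c s\<close> is strictly decreasing in \<open>s\<close>, so every sub-dataset with \<open>U\<^sub>j < U\<close> has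
  \<open>\<rho>\<^sub>j \<le> \<rho>\<^sup>\<star>\<close>. The sub-datasets have about \<open>n\<^sup>1\<^sup>-\<^sup>\<alpha>\<close> items each, so those with \<open>U\<^sub>j = U\<close> contribute
  \<open>n\<close> to the power \<open>\<beta> + (1 - \<alpha>) \<rho> < \<rho>\<close>, the others \<open>n\<close> to the power \<open>\<alpha> + (1 - \<alpha>) \<rho>\<^sup>\<star> < \<rho>\<close> (each
  times a logarithm), and the final selection \<open>n\<close> to the power \<open>\<alpha> < \<rho>\<close>. For correctness, the success
  event of RANGE-LSH is the union of the cylinders over the success events of the sub-datasets, hence
  at least as likely as the success on a sub-dataset that contains an item of inner
  product at least \<open>S0\<close>.\<close>

section \<open>Monotonicity of the exponent\<close>

text \<open>The probability that one sign random projection hashes two unit vectors of inner product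
  \<open>s\<close> to the same value.\<close>

definition collision :: "real \<Rightarrow> real" where
  "collision s = 1 - arccos s / pi"

lemma G_collision: "G c s = ln (collision s) / ln (collision (c * s))"
  by (simp add: G_def collision_def)

lemma collision_1 [simp]: "collision 1 = 1"
  by (simp add: collision_def)

lemma collision_strict_mono:
  assumes "- 1 \<le> s" "s < t" "t \<le> 1"
  shows "collision s < collision t"
  using arccos_less_arccos[of s t] assms by (simp add: collision_def divide_strict_right_mono)

text \<open>The value at 0 is 1/2. Besides positivity, the bound matters because 1/2 exceeds 1/e,
  the point from which \<open>x * (- ln x)\<close> decreases.\<close>

lemma collision_gt_half: "0 < s \<Longrightarrow> s \<le> 1 \<Longrightarrow> 1 / 2 < collision s"
  using collision_strict_mono[of 0 s] by (simp add: collision_def)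

lemma collision_less_1: "- 1 \<le> s \<Longrightarrow> s < 1 \<Longrightarrow> collision s < 1"
  using collision_strict_mono[of s 1] by simp

lemma ln_collision_neg: "0 < s \<Longrightarrow> s < 1 \<Longrightarrow> ln (collision s) < 0"
  using collision_gt_half[of s] collision_less_1[of s] by simp

section \<open>Logarithmic derivative of the collision probability\<close>

lemma DERIV_collision:
  assumes "- 1 < s" "s < 1"
  shows "DERIV collision s :> 1 / (pi * sqrt (1 - s\<^sup>2))"
  unfolding collision_def [abs_def] using assms
  by (auto intro!: derivative_eq_intros simp: field_simps)

text \<open>The factor \<open>1 / (pi * s)\<close> is split off so that, at the argument
  \<open>c * s\<close>, the chain-rule factor \<open>c\<close> cancels and only the remaining
  quotient has to be compared at \<open>c * s\<close> and \<open>s\<close>.\<close>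

lemma DERIV_ln_minus_ln_collision:
  assumes "0 < s" "s < 1"
  shows "DERIV (\<lambda>s. ln (- ln (collision s))) s :>
           - (s / sqrt (1 - s\<^sup>2) / (collision s * (- ln (collision s)))) / (pi * s)"
proof -
  have p: "collision s > 0" "ln (collision s) < 0"
    using collision_gt_half[of s] ln_collision_neg[of s] assms by auto
  have "s\<^sup>2 < 1"
    using assms by (simp add: power_less_one_iff abs_square_less_1)
  then show ?thesis
    using assms p
    by (auto intro!: derivative_eq_intros DERIV_collision[THEN DERIV_chain2] simp: field_simps)
qed

text \<open>The derivative \<open>- ln z - 1\<close> is negative for \<open>z > 1 / 2\<close>: apply
  \<open>ln y \<le> y - 1\<close> at \<open>y = 1 / z < 2\<close>, which avoids any estimate of
  e.\<close>

lemma entropy_term_decreasing: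
  assumes "1 / 2 < x" "x < y" "y \<le> (1 :: real)"
  shows "y * (- ln y) < x * (- ln x)"
proof -
  have "\<exists>d. DERIV (\<lambda>x. x * (- ln x)) z :> d \<and> d < 0" if "x \<le> z" "z \<le> y" for z
  proof (intro exI conjI)
    show "DERIV (\<lambda>x. x * (- ln x)) z :> - ln z - 1"
      using that assms by (auto intro!: derivative_eq_intros simp: field_simps)
    have "- ln z = ln (1 / z)"
      using that assms by (simp add: ln_div)
    also have "\<dots> \<le> 1 / z - 1"
      using that assms by (intro ln_le_minus_one) auto
    also have "\<dots> < 1"
      using that assms by (simp add: field_simps)
    finally show "- ln z - 1 < 0" by simp
  qed
  then show ?thesis
    using DERIV_neg_imp_decreasing[OF assms(2), of "\<lambda>x. x * (- ln x)"] by blast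
qed

text \<open>The numerator increases. The denominator decreases, since \<open>collision\<close>
  increases with values in (1/2, 1), where \<open>x * (- ln x)\<close> is decreasing.\<close>

lemma elasticity_strict_mono:
  assumes "0 < s" "s < t" "t < 1"
  shows "s / sqrt (1 - s\<^sup>2) / (collision s * (- ln (collision s)))
       < t / sqrt (1 - t\<^sup>2) / (collision t * (- ln (collision t)))"
proof (rule frac_less)
  have sq: "t\<^sup>2 < 1" "s\<^sup>2 < t\<^sup>2"
    using assms by (auto simp: abs_square_less_1 power_strict_mono)
  show "s / sqrt (1 - s\<^sup>2) < t / sqrt (1 - t\<^sup>2)"
    using assms sq by (intro frac_less) auto
  show "0 \<le> s / sqrt (1 - s\<^sup>2)"
    using assms sq by simp
  show "0 < collision t * (- ln (collision t))"
    using collision_gt_half[of t] ln_collision_neg[of t] assms by (intro mult_pos_pos) auto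
  show "collision t * (- ln (collision t)) \<le> collision s * (- ln (collision s))"
    using entropy_term_decreasing[of "collision s" "collision t"] collision_gt_half[of s]
      collision_strict_mono[of s t] collision_less_1[of t] assms by auto
qed

section \<open>Range and monotonicity of the exponent function\<close>

lemma G_pos:
  assumes "0 < c" "c < 1" "0 < s" "s < 1"
  shows "0 < G c s"
proof -
  have "c * s < 1"
    using mult_strict_mono[of c 1 s 1] assms by simp
  then show ?thesis
    using ln_collision_neg[of s] ln_collision_neg[of "c * s"] assms
    by (simp add: G_collision divide_neg_neg)
qed

lemma G_1 [simp]: "G c 1 = 0"
  by (simp add: G_collision)

lemma G_less_1:
  assumes "0 < c" "c < 1" "0 < s" "s \<le> 1"
  shows "G c s < 1"
proof -
  have cs: "0 < c * s" "c * s < s"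
    using assms by auto
  have "ln (collision (c * s)) < ln (collision s)"
    using collision_gt_half[of "c * s"] collision_strict_mono[of "c * s" s] cs assms by simp
  then show ?thesis
    using ln_collision_neg[of "c * s"] cs assms by (simp add: G_collision divide_less_eq)
qed

text \<open>Up to the factor \<open>\<pi>\<close>, the function \<open>h\<close> in the proof is minus the logarithmic elasticity of
  \<open>\<lambda>s. - ln (collision s)\<close>, so \<open>(h (c * z) - h z) / (\<pi> * z)\<close> is the logarithmic derivative of
  \<open>G c\<close> at \<open>z\<close>.\<close>

lemma G_strict_antimono:
  assumes c: "0 < c" "c < 1" and st: "0 < s" "s < t" "t \<le> 1"
  shows "G c t < G c s"
\<comment> \<open>At \<open>t = 1\<close> the numerator of \<open>G c t\<close> vanishes and
  \<open>ln (G c t)\<close> carries no information; there positivity of \<open>G c s\<close>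
  suffices.\<close>
proof (cases "t = 1")
  case True
  then show ?thesis using G_pos[of c s] assms by simp
next
  case False
  define h where "h = (\<lambda>s. s / sqrt (1 - s\<^sup>2) / (collision s * (- ln (collision s))))"
  define \<phi> where "\<phi> = (\<lambda>s. ln (- ln (collision s)) - ln (- ln (collision (c * s))))"
  have \<phi>: "\<phi> z = ln (G c z)" if "0 < z" "z < 1" for z
  proof -
    have "c * z < 1" using mult_strict_mono[of c 1 z 1] that c by simp
    then show ?thesis
      using ln_collision_neg[of z] ln_collision_neg[of "c * z"] that c
        ln_div[of "- ln (collision z)" "- ln (collision (c * z))"]
      by (simp add: \<phi>_def G_collision)
  qed
  have "\<exists>d. DERIV \<phi> z :> d \<and> d < 0" if z: "s \<le> z" "z \<le> t" for z
  proof (intro exI conjI)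
    have z': "0 < z" "z < 1" "0 < c * z" "c * z < z" "c * z < 1"
      using z st c False mult_strict_mono[of c 1 z 1] by auto
    have "DERIV (\<lambda>s. ln (- ln (collision (c * s)))) z :> - h (c * z) / (pi * (c * z)) * c"
      unfolding h_def
      by (rule DERIV_chain2[OF DERIV_ln_minus_ln_collision])
         (use z' in \<open>auto intro!: derivative_eq_intros\<close>)
    then have "DERIV \<phi> z :> - h z / (pi * z) - (- h (c * z) / (pi * (c * z)) * c)"
      unfolding \<phi>_def using DERIV_ln_minus_ln_collision[OF z'(1,2)]
      by (intro DERIV_diff) (simp_all add: h_def)
    also have "- h z / (pi * z) - (- h (c * z) / (pi * (c * z)) * c) = (h (c * z) - h z) / (pi * z)"
      using z' c by (simp add: field_simps)
    finally show "DERIV \<phi> z :> (h (c * z) - h z) / (pi * z)" .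
    show "(h (c * z) - h z) / (pi * z) < 0"
      using elasticity_strict_mono[of "c * z" z] z' by (simp add: h_def divide_neg_pos)
  qed
  then have "\<phi> t < \<phi> s"
    using DERIV_neg_imp_decreasing[OF st(2), of \<phi>] by blast
  then show ?thesis
    using \<phi>[of s] \<phi>[of t] G_pos[of c s] G_pos[of c t] assms False by simp
qed

section \<open>Exponents as functions of the maximum norm\<close>

lemma lsh_exponent_nonneg:
  assumes "0 < c" "c < 1" "0 < S0"
  shows "0 \<le> lsh_exponent c S0 V"
  using G_pos[of c "S0 / V"] assms by (cases "S0 = V") (auto simp: lsh_exponent_def)

lemma lsh_exponent_less_1:
  assumes "0 < c" "c < 1" "0 < S0"
  shows "lsh_exponent c S0 V < 1"
  using G_less_1[of c "S0 / V"] assms by (auto simp: lsh_exponent_def)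

text \<open>A larger norm means a smaller argument \<open>S0 / U\<close> of the decreasing
  \<open>G c\<close>. If \<open>V < S0\<close>, the exponent of \<open>V\<close> is the default 0,
  and positivity at \<open>U\<close> gives strictness.\<close>

lemma lsh_exponent_strict_mono:
  assumes c: "0 < c" "c < 1" "0 < S0" and V: "V < U" and pos: "0 < lsh_exponent c S0 U"
  shows "lsh_exponent c S0 V < lsh_exponent c S0 U"
proof (cases "S0 \<le> V")
  case True
  then show ?thesis
    using G_strict_antimono[of c "S0 / U" "S0 / V"] c V
    by (simp add: lsh_exponent_def divide_strict_left_mono)
next
  case False
  then show ?thesis using pos by (simp add: lsh_exponent_def)
qed

section \<open>Success probability\<close>

lemma best_item_Some_max:
  assumes "finite X" "X \<noteq> {}"
  obtains y where "best_item q X = Some y" "y \<in> X" "\<And>x. x \<in> X \<Longrightarrow> x \<bullet> q \<le> y \<bullet> q"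
proof -
  obtain z where "z \<in> X" "z \<bullet> q = Max ((\<lambda>x. x \<bullet> q) ` X)"
    using Max_in[of "(\<lambda>x. x \<bullet> q) ` X"] assms by fastforce
  then have z: "is_arg_max (\<lambda>x. x \<bullet> q) (\<lambda>x. x \<in> X) z"
    using assms(1) by (simp add: is_arg_max_linorder)
  have "is_arg_max (\<lambda>x. x \<bullet> q) (\<lambda>x. x \<in> X) (arg_max_on (\<lambda>x. x \<bullet> q) X)"
    unfolding arg_max_on_def arg_max_def using z by (rule someI)
  then show ?thesis
    using that[of "arg_max_on (\<lambda>x. x \<bullet> q) X"] assms
    by (auto simp: is_arg_max_linorder best_item_def)
qed

text \<open>A maximum reaches a threshold exactly if some element does. This removes the choice
  operator from the success events and later turns success of RANGE-LSH into a union.\<close>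

lemma best_item_ge_iff:
  assumes "finite X" "X \<subseteq> Y"
  shows "(\<exists>y\<in>Y. best_item q X = Some y \<and> y \<bullet> q \<ge> s) \<longleftrightarrow> (\<exists>x\<in>X. x \<bullet> q \<ge> s)"
proof (cases "X = {}")
  case True
  then show ?thesis by (simp add: best_item_def)
next
  case False
  then obtain y where "best_item q X = Some y" "y \<in> X" "\<And>x. x \<in> X \<Longrightarrow> x \<bullet> q \<le> y \<bullet> q"
    using best_item_Some_max assms(1) by blast
  then show ?thesis using assms(2) by fastforce
qed

lemma simple_lsh_inspected_subset: "set (simple_lsh_inspected p D \<omega> q) \<subseteq> set D"
  unfolding simple_lsh_inspected_def using set_take_subset by fastforce

lemma simple_lsh_answer_in_set:
  assumes "simple_lsh_answer p D \<omega> q = Some x"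
  shows "x \<in> set D"
proof -
  have "set (simple_lsh_inspected p D \<omega> q) \<noteq> {}"
    using assms by (auto simp: simple_lsh_answer_def best_item_def)
  then show ?thesis
    using assms best_item_Some_max[of "set (simple_lsh_inspected p D \<omega> q)" q]
      simple_lsh_inspected_subset[of p D \<omega> q]
    unfolding simple_lsh_answer_def by (metis List.finite_set option.inject subsetD)
qed

section \<open>Probability spaces and measurability of the success events\<close>

lemma sets_std_normal_vector [measurable_cong]: "sets std_normal_vector = sets borel"
  by (simp add: std_normal_vector_def)

lemma prob_space_std_normal_vector: "prob_space (std_normal_vector :: 'b::euclidean_space measure)"
proof -
  interpret prob_space "Pi\<^sub>M (Basis :: 'b set) (\<lambda>_. density lborel std_normal_density)"
    by (intro prob_space_PiM prob_space_normal_density) simp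
  show ?thesis
    unfolding std_normal_vector_def
  proof (rule prob_space_distr)
    show "(\<lambda>f. \<Sum>b\<in>Basis. f b *\<^sub>R b) \<in> Pi\<^sub>M (Basis :: 'b set) (\<lambda>_. density lborel std_normal_density) \<rightarrow>\<^sub>M borel"
      by measurable
  qed
qed

lemma prob_space_simple_lsh_space: "prob_space (simple_lsh_space p)"
  unfolding simple_lsh_space_def by (intro prob_space_PiM prob_space_std_normal_vector)

text \<open>The pair \<open>(l, k)\<close> has to be an index of the product space for its
  coordinate to be a measurable map; hence the restriction to existing tables.\<close>

lemma pred_same_bucket:
  assumes "l < tables p"
  shows "Measurable.pred (simple_lsh_space p) (\<lambda>\<omega>. same_bucket p \<omega> V q l x)"
proof -
  have [measurable]: "(\<lambda>\<omega>. \<omega> (l, k)) \<in> simple_lsh_space p \<rightarrow>\<^sub>M borel" if "k < bits p" for k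
    unfolding simple_lsh_space_def using assms that
    by (intro measurable_compose[OF measurable_component_singleton measurable_ident_sets])
       (auto simp: sets_std_normal_vector)
  have [measurable]: "Measurable.pred (simple_lsh_space p) (\<lambda>\<omega>. sgn (\<omega> (l, k) \<bullet> a) = sgn (\<omega> (l, k) \<bullet> b))"
    if "k < bits p" for k and a b :: "'a \<times> real"
    using that by measurable
  have "Measurable.pred (simple_lsh_space p) (\<lambda>\<omega>. \<forall>k\<in>{..<bits p}.
      sgn (\<omega> (l, k) \<bullet> simple_transform (x /\<^sub>R V)) = sgn (\<omega> (l, k) \<bullet> query_transform q))"
    by (intro pred_intros_finite) auto
  then show ?thesis
    by (simp add: same_bucket_def sign_projection_def Ball_def)
qed

text \<open>The inspected items depend on the randomness only through the finitely many bits that say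
  which items share a bucket with the query.\<close>

lemma sets_simple_lsh_inspected:
  "{\<omega> \<in> space (simple_lsh_space p). P (simple_lsh_inspected p D \<omega> q)} \<in> sets (simple_lsh_space p)"
proof -
  define T where "T = {..<tables p} \<times> set D"
  define F where "F = (\<lambda>S. take (budget p) (concat (map (\<lambda>l. filter (\<lambda>x. (l, x) \<in> S) D) [0..<tables p])))"
  define pat where "pat = (\<lambda>\<omega>. {t \<in> T. same_bucket p \<omega> (max_norm D) q (fst t) (snd t)})"
  let ?M = "simple_lsh_space p"
  have F: "simple_lsh_inspected p D \<omega> q = F (pat \<omega>)" for \<omega>
    unfolding simple_lsh_inspected_def F_def pat_def T_def
    by (intro arg_cong[of _ _ "take _"] arg_cong[of _ _ concat] map_cong filter_cong) auto
  have "{\<omega> \<in> space ?M. pat \<omega> = S} \<in> sets ?M" if S: "S \<subseteq> T" for S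
  proof -
    have "Measurable.pred ?M
        (\<lambda>\<omega>. \<forall>t\<in>T. same_bucket p \<omega> (max_norm D) q (fst t) (snd t) = (t \<in> S))"
      by (intro pred_intros_finite pred_intros_logic pred_same_bucket) (auto simp: T_def)
    moreover have "(\<forall>t\<in>T. same_bucket p \<omega> (max_norm D) q (fst t) (snd t) = (t \<in> S)) \<longleftrightarrow> pat \<omega> = S" for \<omega>
      using S by (auto simp: pat_def)
    ultimately show ?thesis by (simp add: pred_def)
  qed
  then have "(\<Union>S\<in>{S \<in> Pow T. P (F S)}. {\<omega> \<in> space ?M. pat \<omega> = S}) \<in> sets ?M"
    by (intro sets.finite_UN) (auto simp: T_def)
  moreover have "{\<omega> \<in> space ?M. P (simple_lsh_inspected p D \<omega> q)}
      = (\<Union>S\<in>{S \<in> Pow T. P (F S)}. {\<omega> \<in> space ?M. pat \<omega> = S})"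
    by (auto simp: F pat_def)
  ultimately show ?thesis by simp
qed

lemma sets_simple_lsh_answer:
  "{\<omega> \<in> space (simple_lsh_space p). P (simple_lsh_answer p D \<omega> q)} \<in> sets (simple_lsh_space p)"
  unfolding simple_lsh_answer_def
  by (rule sets_simple_lsh_inspected[of p "\<lambda>xs. P (best_item q (set xs))"])

section \<open>The sub-datasets as a partition, and correctness of RANGE-LSH\<close>

lemma concat_sub_dataset:
  assumes "k \<le> m" "0 < m"
  shows "concat (map (sub_dataset m R) [1..<Suc k]) = take (k * length R div m) R"
  using assms(1)
proof (induction k)
  case (Suc k)
  \<comment> \<open>The end of range \<open>k\<close> is the start of range \<open>Suc k\<close>, so
    appending the next sub-dataset extends the prefix without gap or overlap.\<close>
  have "k * length R div m \<le> Suc k * length R div m"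
    by (intro div_le_mono) simp
  then show ?case
    using Suc by (simp add: sub_dataset_def)
      (metis append_take_drop_id min.absorb1 take_take)
qed simp

lemma set_sub_dataset_Union:
  assumes "0 < m"
  shows "(\<Union>j\<in>{1..m}. set (sub_dataset m R j)) = set R"
proof -
  have "set R = set (concat (map (sub_dataset m R) [1..<Suc m]))"
    using concat_sub_dataset[of m m R] assms by simp
  also have "\<dots> = (\<Union>j\<in>{1..m}. set (sub_dataset m R j))"
    by (simp only: set_concat set_map set_upt image_image atLeastLessThanSuc_atLeastAtMost)
  finally show ?thesis ..
qed

lemma norm_ranking_set: "norm_ranking D R \<Longrightarrow> set R = set D"
  unfolding norm_ranking_def using mset_eq_setD by blast

lemma norm_ranking_length: "norm_ranking D R \<Longrightarrow> length R = length D"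
  unfolding norm_ranking_def using mset_eq_length by blast

text \<open>Each partial answer lies in its own sub-dataset, hence in \<open>D\<close>; so the
  candidates form a finite set, and the final selection is a maximum over it.\<close>

lemma range_lsh_answer_ge_iff:
  assumes "norm_ranking D R" "0 < m"
  shows "(\<exists>y\<in>set D. range_lsh_answer par m R \<omega> q = Some y \<and> y \<bullet> q \<ge> s) \<longleftrightarrow>
    (\<exists>j\<in>{1..m}. \<exists>y\<in>set (sub_dataset m R j).
       simple_lsh_answer (par (sub_dataset m R j)) (sub_dataset m R j) (\<omega> j) q = Some y \<and> y \<bullet> q \<ge> s)"
proof -
  define X where "X = {x. \<exists>j\<in>{1..m}.
       simple_lsh_answer (par (sub_dataset m R j)) (sub_dataset m R j) (\<omega> j) q = Some x}"
  have X: "X \<subseteq> set D"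
    using set_sub_dataset_Union[OF assms(2), of R] norm_ranking_set[OF assms(1)]
    by (auto simp: X_def dest!: simple_lsh_answer_in_set)
  show ?thesis
    unfolding range_lsh_answer_def X_def[symmetric]
      best_item_ge_iff[OF finite_subset[OF X List.finite_set] X]
    unfolding X_def by (auto dest: simple_lsh_answer_in_set)
qed

text \<open>A sub-dataset containing an item that reaches \<open>S0\<close> succeeds with
  probability at least \<open>1 - \<delta>\<close>, and one such success already forces the best of
  all answers to reach \<open>c * S0\<close>.\<close>

lemma range_lsh_solves:
  fixes D R :: "'a::euclidean_space list"
  assumes solves: "\<And>D :: 'a list. D \<noteq> [] \<Longrightarrow>
      solves_c_mips (simple_lsh_space (par D)) (simple_lsh_answer (par D) D) c S0 \<delta> D"
    and R: "norm_ranking D R" and m: "0 < m"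
  shows "solves_c_mips (range_lsh_space par m R) (range_lsh_answer par m R) c S0 \<delta> D"
  unfolding solves_c_mips_def
proof (intro allI impI, elim conjE bexE)
  fix q x assume q: "norm q = 1" and x: "x \<in> set D" "S0 \<le> x \<bullet> q"
  define S where "S = sub_dataset m R"
  define M where "M = (\<lambda>j. simple_lsh_space (par (S j)) :: (nat \<times> nat \<Rightarrow> 'a \<times> real) measure)"
  define E where "E = (\<lambda>j. {\<omega> \<in> space (M j).
    \<exists>y\<in>set (S j). simple_lsh_answer (par (S j)) (S j) \<omega> q = Some y \<and> y \<bullet> q \<ge> c * S0})"
  have space: "range_lsh_space par m R = Pi\<^sub>M {1..m} M"
    by (simp add: range_lsh_space_def M_def S_def)
  interpret P: prob_space "Pi\<^sub>M {1..m} M"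
    unfolding M_def by (intro prob_space_PiM prob_space_simple_lsh_space)
  have E: "E j \<in> sets (M j)" for j
    unfolding E_def M_def by (rule sets_simple_lsh_answer)
  have cyl: "(\<lambda>\<omega>. \<omega> j) -` E j \<inter> space (Pi\<^sub>M {1..m} M) \<in> sets (Pi\<^sub>M {1..m} M)"
    if "j \<in> {1..m}" for j
    using that E by (intro measurable_sets[OF measurable_component_singleton])
  let ?G = "{\<omega> \<in> space (Pi\<^sub>M {1..m} M).
    \<exists>y\<in>set D. range_lsh_answer par m R \<omega> q = Some y \<and> y \<bullet> q \<ge> c * S0}"
  have G: "?G = (\<Union>j\<in>{1..m}. (\<lambda>\<omega>. \<omega> j) -` E j \<inter> space (Pi\<^sub>M {1..m} M))"
    unfolding range_lsh_answer_ge_iff[OF R m]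
    by (auto simp: E_def S_def space_PiM intro: PiE_mem)
  have "x \<in> (\<Union>j\<in>{1..m}. set (S j))"
    unfolding S_def set_sub_dataset_Union[OF m] norm_ranking_set[OF R] by (rule x(1))
  then obtain j where j: "j \<in> {1..m}" "x \<in> set (S j)" by blast
  have "1 - \<delta> \<le> measure (M j) (E j)"
    using solves[of "S j"] q x j unfolding solves_c_mips_def M_def E_def by fastforce
  \<comment> \<open>The marginal of the product measure at coordinate \<open>j\<close> is
    \<open>M j\<close>, which carries the probability over to the cylinder.\<close>
  also have "\<dots> = measure (distr (Pi\<^sub>M {1..m} M) (M j) (\<lambda>\<omega>. \<omega> j)) (E j)"
    using j by (subst distr_PiM_component) (auto simp: M_def prob_space_simple_lsh_space)
  also have "\<dots> = measure (Pi\<^sub>M {1..m} M) ((\<lambda>\<omega>. \<omega> j) -` E j \<inter> space (Pi\<^sub>M {1..m} M))"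
    using j E by (intro measure_distr) auto
  also have "\<dots> \<le> measure (Pi\<^sub>M {1..m} M) ?G"
    unfolding G using j cyl by (intro P.finite_measure_mono sets.finite_UN) auto
  finally show "1 - \<delta> \<le> measure (range_lsh_space par m R) {\<omega> \<in> space (range_lsh_space par m R).
      \<exists>y\<in>set D. range_lsh_answer par m R \<omega> q = Some y \<and> c * S0 \<le> y \<bullet> q}"
    by (simp only: space)
qed

section \<open>Query time\<close>

lemma length_sub_dataset:
  assumes "j \<in> {1..m}"
  shows "length (sub_dataset m R j) = j * length R div m - (j - 1) * length R div m"
proof -
  have "j * length R div m \<le> m * length R div m"
    using assms by (intro div_le_mono) simp
  then show ?thesis
    using assms by (simp add: sub_dataset_def min_absorb2)
qed

lemma length_sub_dataset_le: "length (sub_dataset m R j) \<le> length R"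
  by (simp add: sub_dataset_def)

text \<open>Before rounding, each range has length \<open>n / m\<close>. Rounding down moves each of
  its two ends by at most 1, in the same direction, so the length changes by at most 1.\<close>

lemma length_sub_dataset_bounds:
  assumes j: "j \<in> {1..m}"
  shows "real (length R) / real m - 1 \<le> real (length (sub_dataset m R j))"
    and "real (length (sub_dataset m R j)) \<le> real (length R) / real m + 1"
proof -
  let ?n = "length R"
  have div_bounds: "real a / real m - 1 \<le> real (a div m)" "real (a div m) \<le> real a / real m" for a
    using floor_divide_of_nat_eq[of a m, where 'a = real] by linarith+
  have "(j - 1) * ?n div m \<le> j * ?n div m"
    by (intro div_le_mono) simp
  then have len: "real (length (sub_dataset m R j)) = real (j * ?n div m) - real ((j - 1) * ?n div m)"
    unfolding length_sub_dataset[OF j] by (rule of_nat_diff)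
  have "real (j * ?n) / real m - real ((j - 1) * ?n) / real m = real ?n / real m"
    using j by (simp add: of_nat_diff flip: diff_divide_distrib) (simp add: algebra_simps)
  then show "real ?n / real m - 1 \<le> real (length (sub_dataset m R j))"
    and "real (length (sub_dataset m R j)) \<le> real ?n / real m + 1"
    using div_bounds[of "j * ?n"] div_bounds[of "(j - 1) * ?n"]
    unfolding len by linarith+
qed

lemma set_sub_dataset_subset: "set (sub_dataset m R j) \<subseteq> set R"
  unfolding sub_dataset_def using set_drop_subset set_take_subset by fastforce

lemma max_norm_mono:
  assumes "set D' \<subseteq> set D" "D' \<noteq> []"
  shows "max_norm D' \<le> max_norm D"
  unfolding max_norm_def using assms by (intro Max_mono) auto

text \<open>Once \<open>n powr \<alpha> \<ge> 2\<close>, the rounding error below 1 keeps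
  \<open>m\<close> within a factor 2 of \<open>n powr \<alpha>\<close>. Then \<open>n / m\<close>
  lies between half and twice \<open>n powr (1 - \<alpha>)\<close>; the threshold 6 gives
  \<open>n / m \<ge> 3\<close>, hence the two items that the SIMPLE-LSH time guarantee
  requires.\<close>

lemma range_lsh_setting_length:
  assumes set: "range_lsh_setting c S0 \<alpha> \<beta> \<rho> \<rho>star D R m"
    and n: "D \<noteq> []" "2 \<le> real (length D) powr \<alpha>" "6 \<le> real (length D) powr (1 - \<alpha>)"
  shows "real (length D) powr \<alpha> / 2 \<le> real m" "real m \<le> 2 * real (length D) powr \<alpha>"
    and "j \<in> {1..m} \<Longrightarrow> 2 \<le> length (sub_dataset m R j)"
    and "j \<in> {1..m} \<Longrightarrow> length (sub_dataset m R j) \<le> length D"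
    and "j \<in> {1..m} \<Longrightarrow> real (length (sub_dataset m R j)) \<le> 4 * real (length D) powr (1 - \<alpha>)"
proof -
  define x where "x = real (length D)"
  have x: "0 < x" using n by (simp add: x_def)
  have R: "norm_ranking D R" "\<bar>real m - x powr \<alpha>\<bar> < 1"
    using set by (simp_all add: range_lsh_setting_def Let_def x_def)
  have len: "real (length R) = x"
    using norm_ranking_length[OF R(1)] by (simp add: x_def)
  show m: "real (length D) powr \<alpha> / 2 \<le> real m" "real m \<le> 2 * real (length D) powr \<alpha>"
    using R(2) n by (auto simp: x_def)
  have pos: "0 < real m" using m(1) n by linarith
  have split: "x powr \<alpha> * x powr (1 - \<alpha>) = x"
    using x by (simp flip: powr_add)
  have "x / real m \<le> x / (x powr \<alpha> / 2)"
    using m x pos by (intro divide_left_mono) (auto simp: x_def)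
  also have "\<dots> = 2 * x powr (1 - \<alpha>)"
    using x split by (simp add: powr_diff)
  finally have up: "x / real m \<le> 2 * x powr (1 - \<alpha>)" .
  have "x powr (1 - \<alpha>) / 2 = x / (2 * x powr \<alpha>)"
    using x by (simp add: powr_diff)
  also have "\<dots> \<le> x / real m"
    using m x pos by (intro divide_left_mono) (auto simp: x_def)
  finally have low: "x powr (1 - \<alpha>) / 2 \<le> x / real m" .
  show "length (sub_dataset m R j) \<le> length D"
    using length_sub_dataset_le[of m R j] norm_ranking_length[OF R(1)] by simp
  assume j: "j \<in> {1..m}"
  show "2 \<le> length (sub_dataset m R j)"
  proof -
    have "2 \<le> real (length (sub_dataset m R j))"
      using length_sub_dataset_bounds(1)[OF j, of R] low n(3) unfolding len x_def by linarith
    then show ?thesis by simp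
  qed
  show "real (length (sub_dataset m R j)) \<le> 4 * real (length D) powr (1 - \<alpha>)"
    using length_sub_dataset_bounds(2)[OF j, of R] up n by (simp add: len x_def)
qed

text \<open>Since \<open>\<rho>star\<close> is a \<open>Max\<close>, it is meaningful only for a
  nonempty set. Fewer than \<open>m\<close> sub-datasets attain the maximum norm, so some exponent
  below \<open>\<rho>\<close> exists and \<open>\<rho>star\<close> is one of them.\<close>

lemma range_lsh_setting_exponents:
  fixes D R :: "'a::real_normed_vector list"
  assumes c: "0 < c" "c < 1" "0 < S0" and "0 < \<rho>"
    and set: "range_lsh_setting c S0 \<alpha> \<beta> \<rho> \<rho>star D R m"
    and n: "D \<noteq> []" "2 \<le> real (length D) powr \<alpha>" "6 \<le> real (length D) powr (1 - \<alpha>)"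
      "2 < real (length D) powr (\<alpha> - \<beta>)"
  shows "0 \<le> \<rho>star" "\<rho>star < \<rho>"
    and "\<And>j. j \<in> {1..m} \<Longrightarrow> max_norm (sub_dataset m R j) \<noteq> max_norm D \<Longrightarrow>
      lsh_exponent c S0 (max_norm (sub_dataset m R j)) \<le> \<rho>star"
proof -
  define x where "x = real (length D)"
  define Uj where "Uj = (\<lambda>j. max_norm (sub_dataset m R j))"
  define X where "X = {lsh_exponent c S0 (Uj j) | j. j \<in> {1..m} \<and> lsh_exponent c S0 (Uj j) < \<rho>}"
  have R: "norm_ranking D R" "real (card {j \<in> {1..m}. Uj j = max_norm D}) \<le> x powr \<beta>"
    "\<rho> = lsh_exponent c S0 (max_norm D)" "\<rho>star = Max X"
    using set by (simp_all add: range_lsh_setting_def Let_def x_def X_def Uj_def)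
  note len = range_lsh_setting_length[OF set n(1-3)]
  have X: "finite X" unfolding X_def by simp
  have below: "lsh_exponent c S0 (Uj j) \<in> X" if j: "j \<in> {1..m}" "Uj j \<noteq> max_norm D" for j
  proof -
    \<comment> \<open>The maximum is monotone only for a nonempty sub-dataset, which the lower bound
      2 on its length ensures.\<close>
    have "Uj j \<le> max_norm D"
      using len(3)[OF j(1)] set_sub_dataset_subset[of m R j] norm_ranking_set[OF R(1)]
      unfolding Uj_def by (intro max_norm_mono) auto
    then have "lsh_exponent c S0 (Uj j) < \<rho>"
      using lsh_exponent_strict_mono[OF c, of "Uj j" "max_norm D"] j \<open>0 < \<rho>\<close> R(3) by simp
    then show ?thesis using j unfolding X_def by blast
  qed
  then show "lsh_exponent c S0 (max_norm (sub_dataset m R j)) \<le> \<rho>star"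
    if "j \<in> {1..m}" "max_norm (sub_dataset m R j) \<noteq> max_norm D" for j
    using that X Max_ge R(4) unfolding Uj_def by blast
  \<comment> \<open>Together with \<open>m \<ge> x powr \<alpha> / 2\<close> this puts the number of
    maximum-norm sub-datasets strictly below \<open>m\<close>.\<close>
  have "2 * x powr \<beta> < x powr \<alpha>"
    using n(1,4) by (simp add: x_def powr_diff field_simps)
  then have "real (card {j \<in> {1..m}. Uj j = max_norm D}) < real (card {1..m})"
    using R(2) len(1) by (simp add: x_def)
  then have "{j \<in> {1..m}. Uj j = max_norm D} \<noteq> {1..m}" by force
  then have "X \<noteq> {}" using below by blast
  then have "\<rho>star \<in> X" using X R(4) by simp
  then show "0 \<le> \<rho>star" "\<rho>star < \<rho>"
    using lsh_exponent_nonneg[OF c] unfolding X_def by auto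
qed

section \<open>Adding the bounds over the sub-datasets\<close>

lemma range_lsh_time_le_bound:
  fixes R :: "'a::euclidean_space list"
  assumes time: "\<And>(D :: 'a list) q \<omega>. \<omega> \<in> space (simple_lsh_space (par D)) \<Longrightarrow> length D \<ge> 2 \<Longrightarrow>
      norm q = 1 \<Longrightarrow>
      real (simple_lsh_time (par D) D \<omega> q) \<le> A * simple_lsh_bound c S0 (length D) (max_norm D)"
    and len: "\<And>j. j \<in> {1..m} \<Longrightarrow> 2 \<le> length (sub_dataset m R j)"
    and \<omega>: "\<omega> \<in> space (range_lsh_space par m R)" and q: "norm q = 1"
  shows "real (range_lsh_time par m R \<omega> q) \<le> range_lsh_bound A 1 c S0 m R"
proof -
  have "(\<Sum>j=1..m. real (simple_lsh_time (par (sub_dataset m R j)) (sub_dataset m R j) (\<omega> j) q))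
      \<le> (\<Sum>j=1..m. A * simple_lsh_bound c S0 (length (sub_dataset m R j)) (max_norm (sub_dataset m R j)))"
  proof (rule sum_mono)
    fix j assume j: "j \<in> {1..m}"
    have "\<omega> j \<in> space (simple_lsh_space (par (sub_dataset m R j)))"
      using PiE_mem[OF \<omega>[unfolded range_lsh_space_def space_PiM] j] .
    then show "real (simple_lsh_time (par (sub_dataset m R j)) (sub_dataset m R j) (\<omega> j) q)
        \<le> A * simple_lsh_bound c S0 (length (sub_dataset m R j)) (max_norm (sub_dataset m R j))"
      using len[OF j] q by (rule time)
  qed
  \<comment> \<open>The final selection is counted as \<open>m\<close> steps, which is the constant
    \<open>C = 1\<close>.\<close>
  then show ?thesis
    by (simp add: range_lsh_time_def range_lsh_bound_def)
qed

text \<open>With \<open>n powr \<rho> * ln n\<close> factored out, one power of \<open>n\<close>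
  remains for each source of cost: the sub-datasets of maximum norm, the other sub-datasets, and the
  final selection. The theorem then only needs the three exponents to be negative.\<close>

lemma range_lsh_bound_le:
  fixes D R :: "'a::real_normed_vector list"
  assumes c: "0 < c" "c < 1" "0 < S0" and \<rho>: "0 < \<rho>" and pos: "0 \<le> A" "0 \<le> C"
    and set: "range_lsh_setting c S0 \<alpha> \<beta> \<rho> \<rho>star D R m"
    and n: "3 \<le> length D" "2 \<le> real (length D) powr \<alpha>" "6 \<le> real (length D) powr (1 - \<alpha>)"
      "2 < real (length D) powr (\<alpha> - \<beta>)"
  shows "range_lsh_bound A C c S0 m R \<le>
    (4 * A * real (length D) powr (\<beta> - \<alpha> * \<rho>)
     + 8 * A * real (length D) powr (\<alpha> * (1 - \<rho>star) - (\<rho> - \<rho>star))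
     + 2 * C * real (length D) powr (\<alpha> - \<rho>))
    * simple_lsh_bound c S0 (length D) (max_norm D)"
proof -
  define x where "x = real (length D)"
  define N where "N = (\<lambda>j. length (sub_dataset m R j))"
  define Uj where "Uj = (\<lambda>j. max_norm (sub_dataset m R j))"
  define e where "e = (\<lambda>j. lsh_exponent c S0 (Uj j))"
  define J where "J = {j \<in> {1..m}. Uj j = max_norm D}"
  have D: "D \<noteq> []" and x: "3 \<le> x" using n by (auto simp: x_def)
  note len = range_lsh_setting_length[OF set D n(2,3)]
  note exps = range_lsh_setting_exponents[OF c \<rho> set D n(2-4)]
  have R: "real (card J) \<le> x powr \<beta>" "\<rho> = lsh_exponent c S0 (max_norm D)"
    using set by (simp_all add: range_lsh_setting_def Let_def x_def Uj_def J_def)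
  have \<rho>1: "\<rho> < 1" using lsh_exponent_less_1[OF c] R(2) by simp
  \<comment> \<open>The threshold 3 is at least e; this lets the selection cost, which has no
    logarithm, be multiplied by \<open>ln x\<close>.\<close>
  have ln: "1 \<le> ln x"
  proof -
    have "exp 1 \<le> x" using exp_le x by linarith
    then show ?thesis using x by (simp add: ln_ge_iff)
  qed
  \<comment> \<open>A common upper bound for all sub-dataset sizes; \<open>1 \<le> Y\<close> allows
    an exponent to be replaced by a larger one.\<close>
  define Y where "Y = 4 * x powr (1 - \<alpha>)"
  have Y: "1 \<le> Y" using n by (simp add: Y_def x_def)
  have Yr: "Y powr r \<le> 4 * x powr ((1 - \<alpha>) * r)" if "0 \<le> r" "r \<le> 1" for r
  proof -
    have "Y powr r = 4 powr r * x powr ((1 - \<alpha>) * r)"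
      by (simp add: Y_def powr_mult powr_powr)
    moreover have "4 powr r \<le> (4::real) powr 1"
      using that by (intro powr_mono) auto
    ultimately show ?thesis by (simp add: mult_right_mono)
  qed
  have bound: "A * simple_lsh_bound c S0 (N j) (Uj j) \<le> A * (Y powr r * ln x)"
    if j: "j \<in> {1..m}" and r: "e j \<le> r" for j r
  proof -
    have "real (N j) powr e j \<le> Y powr e j"
      using len(5)[OF j] lsh_exponent_nonneg[OF c]
      by (intro powr_mono2) (auto simp: N_def Y_def x_def e_def)
    also have "\<dots> \<le> Y powr r"
      using Y r by (intro powr_mono)
    finally have *: "real (N j) powr e j \<le> Y powr r" .
    have "1 \<le> real (N j)" "real (N j) \<le> x"
      using len(3,4)[OF j] by (simp_all add: N_def x_def)
    then have "ln (real (N j)) \<le> ln x" "0 \<le> ln (real (N j))"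
      using ln_mono[of "real (N j)" x] by auto
    then have "real (N j) powr e j * ln (real (N j)) \<le> Y powr r * ln x"
      using * by (intro mult_mono) auto
    then show ?thesis
      using pos by (simp add: simple_lsh_bound_def e_def mult_left_mono)
  qed
  let ?f = "\<lambda>j. A * simple_lsh_bound c S0 (N j) (Uj j)"
  have J: "finite J" "J \<subseteq> {1..m}" by (auto simp: J_def)
  have "sum ?f J \<le> real (card J) * (A * (Y powr \<rho> * ln x))"
    using R(2) by (intro sum_bounded_above bound) (auto simp: J_def e_def)
  also have "\<dots> \<le> x powr \<beta> * (A * ((4 * x powr ((1 - \<alpha>) * \<rho>)) * ln x))"
    using R(1) Yr[of \<rho>] \<rho> \<rho>1 ln pos
    by (intro mult_mono mult_left_mono mult_right_mono mult_nonneg_nonneg) auto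
  also have "\<dots> = 4 * A * (x powr \<beta> * x powr ((1 - \<alpha>) * \<rho>)) * ln x"
    by simp
  \<comment> \<open>Here \<open>\<beta> + (1 - \<alpha>) * \<rho> = (\<beta> - \<alpha> * \<rho>) +
    \<rho>\<close>.\<close>
  also have "x powr \<beta> * x powr ((1 - \<alpha>) * \<rho>) = x powr (\<beta> - \<alpha> * \<rho>) * x powr \<rho>"
    by (simp add: algebra_simps flip: powr_add)
  finally have 1: "sum ?f J \<le> 4 * A * (x powr (\<beta> - \<alpha> * \<rho>) * x powr \<rho>) * ln x" .
  \<comment> \<open>For these sub-datasets the crude count
    \<open>m \<le> 2 * x powr \<alpha>\<close> is enough, because their exponents are at most
    \<open>\<rho>star\<close>.\<close>
  have "sum ?f ({1..m} - J) \<le> real (card ({1..m} - J)) * (A * (Y powr \<rho>star * ln x))"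
    using exps(3) by (intro sum_bounded_above bound) (auto simp: J_def e_def Uj_def)
  also have "\<dots> \<le> (2 * x powr \<alpha>) * (A * ((4 * x powr ((1 - \<alpha>) * \<rho>star)) * ln x))"
  proof -
    have "card ({1..m} - J) \<le> m"
      using card_mono[of "{1..m}" "{1..m} - J"] by simp
    then have "real (card ({1..m} - J)) \<le> 2 * x powr \<alpha>"
      using len(2) by (simp add: x_def)
    then show ?thesis
      using Yr[of \<rho>star] exps(1,2) \<rho>1 ln pos
      by (intro mult_mono mult_left_mono mult_right_mono mult_nonneg_nonneg) auto
  qed
  also have "\<dots> = 8 * A * (x powr \<alpha> * x powr ((1 - \<alpha>) * \<rho>star)) * ln x"
    by simp
  also have "x powr \<alpha> * x powr ((1 - \<alpha>) * \<rho>star)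
      = x powr (\<alpha> * (1 - \<rho>star) - (\<rho> - \<rho>star)) * x powr \<rho>"
    by (simp add: algebra_simps flip: powr_add)
  finally have 2: "sum ?f ({1..m} - J)
      \<le> 8 * A * (x powr (\<alpha> * (1 - \<rho>star) - (\<rho> - \<rho>star)) * x powr \<rho>) * ln x" .
  have "C * real m \<le> C * (2 * x powr \<alpha>) * ln x"
  proof -
    have "C * real m \<le> C * (2 * x powr \<alpha>) * 1"
      using len(2) pos by (simp add: x_def mult_left_mono)
    also have "\<dots> \<le> C * (2 * x powr \<alpha>) * ln x"
      using ln pos by (intro mult_left_mono) auto
    finally show ?thesis .
  qed
  also have "x powr \<alpha> = x powr (\<alpha> - \<rho>) * x powr \<rho>"
    by (simp flip: powr_add)
  finally have 3: "C * real m \<le> C * (2 * (x powr (\<alpha> - \<rho>) * x powr \<rho>)) * ln x" .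
  have "range_lsh_bound A C c S0 m R = sum ?f J + sum ?f ({1..m} - J) + C * real m"
    using sum.subset_diff[OF J(2), of ?f] by (simp add: range_lsh_bound_def N_def Uj_def)
  also have "\<dots> \<le> 4 * A * (x powr (\<beta> - \<alpha> * \<rho>) * x powr \<rho>) * ln x
      + 8 * A * (x powr (\<alpha> * (1 - \<rho>star) - (\<rho> - \<rho>star)) * x powr \<rho>) * ln x
      + C * (2 * (x powr (\<alpha> - \<rho>) * x powr \<rho>)) * ln x"
    by (intro add_mono 1 2 3)
  also have "\<dots> = (4 * A * x powr (\<beta> - \<alpha> * \<rho>)
      + 8 * A * x powr (\<alpha> * (1 - \<rho>star) - (\<rho> - \<rho>star))
      + 2 * C * x powr (\<alpha> - \<rho>)) * (x powr \<rho> * ln x)"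
    by (simp add: algebra_simps)
  finally show ?thesis
    by (simp add: simple_lsh_bound_def R(2) x_def)
qed

text \<open>The comparison of orders is stated as a little-o: for any hidden constants
  \<open>A'\<close> and \<open>C\<close>, the RANGE-LSH bound falls below every fixed multiple
  \<open>\<epsilon>\<close> of the SIMPLE-LSH bound. The threshold \<open>n0\<close> is uniform in
  the dataset, its ranking and \<open>m\<close>.\<close>

theorem theorem1:
  fixes c S0 \<delta> \<alpha> \<beta> \<rho> \<rho>star A :: real
    and par :: "(real ^ 'd) list \<Rightarrow> lsh_params"
  assumes "0 < c" "c < 1" "0 < S0" "0 < \<delta>"
    and "simple_lsh_guarantee c S0 \<delta> A par"
    and "0 < \<alpha>" "\<alpha> < min \<rho> ((\<rho> - \<rho>star) / (1 - \<rho>star))"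
    and "0 < \<beta>" "\<beta> < \<alpha> * \<rho>"
  shows
    "(\<forall>D R m. norm_ranking D R \<and> 0 < m \<longrightarrow>
        solves_c_mips (range_lsh_space par m R) (range_lsh_answer par m R) c S0 \<delta> D)
     \<and>
     (\<exists>n0. \<forall>(D :: (real ^ 'd) list) R m.
        n0 \<le> length D \<and> range_lsh_setting c S0 \<alpha> \<beta> \<rho> \<rho>star D R m \<longrightarrow>
        (\<forall>q. \<forall>\<omega>\<in>space (range_lsh_space par m R). norm q = 1 \<longrightarrow>
           real (range_lsh_time par m R \<omega> q) \<le> range_lsh_bound A 1 c S0 m R))
     \<and>
     (\<forall>A' > 0. \<forall>C > 0. \<forall>\<epsilon> > 0. \<exists>n0. \<forall>(D :: (real ^ 'd) list) R m.
        n0 \<le> length D \<and> range_lsh_setting c S0 \<alpha> \<beta> \<rho> \<rho>star D R m \<longrightarrow>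
        range_lsh_bound A' C c S0 m R < \<epsilon> * simple_lsh_bound c S0 (length D) (max_norm D))"
proof (intro conjI allI impI)
  fix D R :: "(real ^ 'd) list" and m :: nat
  assume "norm_ranking D R \<and> 0 < m"
  then show "solves_c_mips (range_lsh_space par m R) (range_lsh_answer par m R) c S0 \<delta> D"
    using assms(5) by (intro range_lsh_solves) (auto simp: simple_lsh_guarantee_def)
next
  note c = assms(1-3)
  have \<alpha>: "0 < \<alpha>" "\<alpha> < \<rho>" "\<alpha> < (\<rho> - \<rho>star) / (1 - \<rho>star)" and \<beta>: "\<beta> < \<alpha> * \<rho>"
    and \<rho>: "0 < \<rho>"
    using assms by auto
  define large where "large = (\<lambda>n. 3 \<le> n \<and> 2 \<le> real n powr \<alpha> \<and> 6 \<le> real n powr (1 - \<alpha>)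
    \<and> 2 < real n powr (\<alpha> - \<beta>))"
  \<comment> \<open>From \<open>\<rho> < 1\<close> follow \<open>\<alpha> < 1\<close> and
    \<open>\<beta> < \<alpha> * \<rho> < \<alpha>\<close>, so all three powers tend to
    infinity.\<close>
  have large: "eventually large sequentially" if "\<rho> < 1"
  proof -
    have "\<alpha> * \<rho> < \<alpha>" using that \<alpha> by simp
    then have "\<beta> < \<alpha>" "\<alpha> < 1" using \<alpha>(2) \<beta> that by linarith+
    then show ?thesis
      unfolding large_def using \<alpha>(1) by (intro eventually_conj; real_asymp)
  qed
  \<comment> \<open>A setting identifies the parameter \<open>\<rho>\<close> with an exponent of
    SIMPLE-LSH; for \<open>\<rho> \<ge> 1\<close> no setting exists and the asymptotic claims are
    vacuous.\<close>
  have \<rho>1: "\<rho> < 1" if "range_lsh_setting c S0 \<alpha> \<beta> \<rho> \<rho>star D R m" for D R :: "(real ^ 'd) list" and m :: nat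
    using that lsh_exponent_less_1[OF c] by (simp add: range_lsh_setting_def Let_def)
  show "\<exists>n0. \<forall>(D :: (real ^ 'd) list) R m.
      n0 \<le> length D \<and> range_lsh_setting c S0 \<alpha> \<beta> \<rho> \<rho>star D R m \<longrightarrow>
      (\<forall>q. \<forall>\<omega>\<in>space (range_lsh_space par m R). norm q = 1 \<longrightarrow>
         real (range_lsh_time par m R \<omega> q) \<le> range_lsh_bound A 1 c S0 m R)"
  proof (cases "\<rho> < 1")
    case True
    then obtain n0 where n0: "\<And>n. n0 \<le> n \<Longrightarrow> large n"
      using large by (auto simp: eventually_sequentially)
    show ?thesis
    proof (intro exI[of _ n0] allI impI ballI, elim conjE)
      fix D R :: "(real ^ 'd) list" and m :: nat and q :: "real ^ 'd" and \<omega>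
      assume n: "n0 \<le> length D" and set: "range_lsh_setting c S0 \<alpha> \<beta> \<rho> \<rho>star D R m"
        and \<omega>: "\<omega> \<in> space (range_lsh_space par m R)" and q: "norm q = 1"
      have "2 \<le> length (sub_dataset m R j)" if "j \<in> {1..m}" for j
        using n0[OF n] that by (intro range_lsh_setting_length(3)[OF set]) (auto simp: large_def)
      then show "real (range_lsh_time par m R \<omega> q) \<le> range_lsh_bound A 1 c S0 m R"
        using assms(5) \<omega> q
        by (intro range_lsh_time_le_bound) (auto simp: simple_lsh_guarantee_def)
    qed
  qed (use \<rho>1 in blast)
  fix A' C \<epsilon> :: real
  assume pos: "0 < A'" "0 < C" "0 < \<epsilon>"
  show "\<exists>n0. \<forall>(D :: (real ^ 'd) list) R m.
      n0 \<le> length D \<and> range_lsh_setting c S0 \<alpha> \<beta> \<rho> \<rho>star D R m \<longrightarrow>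
      range_lsh_bound A' C c S0 m R < \<epsilon> * simple_lsh_bound c S0 (length D) (max_norm D)"
  \<comment> \<open>Every setting with a large enough dataset satisfies both inequalities; if one
    fails, \<open>n0\<close> is chosen so that no setting remains.\<close>
  proof (cases "\<rho> < 1 \<and> \<rho>star < \<rho>")
    case True
    define b where "b = \<alpha> * (1 - \<rho>star) - (\<rho> - \<rho>star)"
    \<comment> \<open>The middle inequality is
      \<open>\<alpha> < (\<rho> - \<rho>star) / (1 - \<rho>star)\<close> multiplied by
      \<open>1 - \<rho>star\<close>, which is positive because
      \<open>\<rho>star < \<rho> < 1\<close>.\<close>
    have neg: "\<beta> - \<alpha> * \<rho> < 0" "b < 0" "\<alpha> - \<rho> < 0"
      using True \<alpha> \<beta> by (simp_all add: b_def less_divide_eq)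
    have "((\<lambda>n. 4 * A' * real n powr (\<beta> - \<alpha> * \<rho>) + 8 * A' * real n powr b
        + 2 * C * real n powr (\<alpha> - \<rho>)) \<longlongrightarrow> 4 * A' * 0 + 8 * A' * 0 + 2 * C * 0) sequentially"
      by (intro tendsto_intros tendsto_neg_powr neg filterlim_real_sequentially)
    then have "eventually (\<lambda>n. 4 * A' * real n powr (\<beta> - \<alpha> * \<rho>) + 8 * A' * real n powr b
        + 2 * C * real n powr (\<alpha> - \<rho>) < \<epsilon>) sequentially"
      using pos by (intro order_tendstoD(2)[of _ 0]) auto
    then have "eventually (\<lambda>n. large n \<and> 4 * A' * real n powr (\<beta> - \<alpha> * \<rho>) + 8 * A' * real n powr b
        + 2 * C * real n powr (\<alpha> - \<rho>) < \<epsilon>) sequentially"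
      using large True by (intro eventually_conj) auto
    then obtain n0 where n0: "\<And>n. n0 \<le> n \<Longrightarrow> large n"
      "\<And>n. n0 \<le> n \<Longrightarrow> 4 * A' * real n powr (\<beta> - \<alpha> * \<rho>) + 8 * A' * real n powr b
        + 2 * C * real n powr (\<alpha> - \<rho>) < \<epsilon>"
      by (auto simp: eventually_sequentially)
    show ?thesis
    proof (intro exI[of _ n0] allI impI, elim conjE)
      fix D R :: "(real ^ 'd) list" and m :: nat
      assume n: "n0 \<le> length D" and set: "range_lsh_setting c S0 \<alpha> \<beta> \<rho> \<rho>star D R m"
      have "range_lsh_bound A' C c S0 m R \<le>
          (4 * A' * real (length D) powr (\<beta> - \<alpha> * \<rho>) + 8 * A' * real (length D) powr b
            + 2 * C * real (length D) powr (\<alpha> - \<rho>))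
          * simple_lsh_bound c S0 (length D) (max_norm D)"
        unfolding b_def using n0(1)[OF n] pos
        by (intro range_lsh_bound_le[OF c \<rho> _ _ set]) (auto simp: large_def)
      also have "\<dots> < \<epsilon> * simple_lsh_bound c S0 (length D) (max_norm D)"
      proof (intro mult_strict_right_mono n0(2)[OF n])
        have "3 \<le> length D" using n0(1)[OF n] by (simp add: large_def)
        then show "0 < simple_lsh_bound c S0 (length D) (max_norm D)"
          unfolding simple_lsh_bound_def by (intro mult_pos_pos ln_gt_zero) auto
      qed
      finally show "range_lsh_bound A' C c S0 m R
          < \<epsilon> * simple_lsh_bound c S0 (length D) (max_norm D)" .
    qed
  next
    case False
    show ?thesis
    proof (cases "\<rho> < 1")
      case True
      then obtain n0 where n0: "\<And>n. n0 \<le> n \<Longrightarrow> large n"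
        using large by (auto simp: eventually_sequentially)
      have "\<not> range_lsh_setting c S0 \<alpha> \<beta> \<rho> \<rho>star D R m" if n: "n0 \<le> length D"
        for D R :: "(real ^ 'd) list" and m :: nat
      proof
        assume set: "range_lsh_setting c S0 \<alpha> \<beta> \<rho> \<rho>star D R m"
        have "\<rho>star < \<rho>"
          using n0[OF n] by (intro range_lsh_setting_exponents(2)[OF c \<rho> set]) (auto simp: large_def)
        then show "False" using False True by blast
      qed
      then show ?thesis by blast
    qed (use \<rho>1 in blast)
  qed
qed

end
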